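(* Let $X\subseteq\mathbb{R}^d$ be a full-dimensional convex body and let $\lambda>0$ be such that some translate $c+\lambda^{-1}[0,1]^d$ ($c\in\mathbb{R}^d$) is contained in $X$. Then for every real $n>0$, $$\mathrm{Flt}^{\mathbb{R}}_d(X)\le\tfrac1n\,\mathrm{Flt}_d(n\cdot X)\le\tfrac{n+\lambda}{n}\,\mathrm{Flt}^{\mathbb{R}}_d(X).$$ In particular $\frac1n\mathrm{Flt}_d(nX)\to\mathrm{Flt}^{\mathbb{R}}_d(X)$ as $n\to\infty$.
   Context: Convex body: non-empty compact convex subset of $\mathbb{R}^d$; $\mathrm{width}(K)=\min_{u\in(\mathbb{Z}^d)^*\setminus\{0\}}\max_{x,y\in K}|u(x)-u(y)|$. A unimodular (resp. $\mathbb{R}$-unimodular) copy of $Y\subseteq\mathbb{R}^d$ is $\{Ay+b:y\in Y\}$ with $A\in\mathrm{GL}(d,\mathbb{Z})$ and $b\in\mathbb{Z}^d$ (resp. $b\in\mathbb{R}^d$). For bounded $X$: $\mathrm{Flt}_d(X)=\sup\{\mathrm{width}(K): K\text{ convex body not containing a unimodular copy of }X\}$ and $\mathrm{Flt}^{\mathbb{R}}_d(X)=\sup\{\mathrm{width}(K): K\text{ convex body not containing an }\mathbb{R}\text{-unimodular copy of }X\}$. *)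

theory Defs
  imports "HOL-Analysis.Analysis"
begin

text \<open>Dimension d is the cardinality of the finite index type 'n; points of R^d are real^'n.\<close>

definition convex_body :: "(real^'n) set \<Rightarrow> bool" where
  "convex_body K \<longleftrightarrow> K \<noteq> {} \<and> compact K \<and> convex K"

definition int_vec :: "real^'n \<Rightarrow> bool" where
  "int_vec v \<longleftrightarrow> (\<forall>i. v $ i \<in> \<int>)"

text \<open>GL(d,Z): integer matrices with determinant 1 or -1 (i.e. invertible over Z).\<close>
definition GL_int :: "(real^'n^'n) \<Rightarrow> bool" where
  "GL_int A \<longleftrightarrow> (\<forall>i j. A $ i $ j \<in> \<int>) \<and> (det A = 1 \<or> det A = -1)"

text \<open>Lattice width: min over nonzero integer functionals u of max over x,y in K of |u(x)-u(y)|.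
  (For a convex body the infimum/supremum are attained.)\<close>
definition lattice_width :: "(real^'n) set \<Rightarrow> real" where
  "lattice_width K = (INF u \<in> {u. int_vec u \<and> u \<noteq> 0}.
      (SUP p \<in> K \<times> K. \<bar>u \<bullet> fst p - u \<bullet> snd p\<bar>))"

definition unimodular_copy :: "(real^'n^'n) \<Rightarrow> real^'n \<Rightarrow> (real^'n) set \<Rightarrow> (real^'n) set" where
  "unimodular_copy A b Y = (\<lambda>y. A *v y + b) ` Y"

definition contains_unimodular_copy :: "(real^'n) set \<Rightarrow> (real^'n) set \<Rightarrow> bool" where
  "contains_unimodular_copy K Y \<longleftrightarrow>
     (\<exists>A b. GL_int A \<and> int_vec b \<and> unimodular_copy A b Y \<subseteq> K)"

definition contains_R_unimodular_copy :: "(real^'n) set \<Rightarrow> (real^'n) set \<Rightarrow> bool" where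
  "contains_R_unimodular_copy K Y \<longleftrightarrow>
     (\<exists>A b. GL_int A \<and> unimodular_copy A b Y \<subseteq> K)"

text \<open>Flatness constants, as extended reals (the supremum may a priori be infinite).\<close>
definition Flt :: "(real^'n) set \<Rightarrow> ereal" where
  "Flt X = Sup {ereal (lattice_width K) | K. convex_body K \<and> \<not> contains_unimodular_copy K X}"

definition FltR :: "(real^'n) set \<Rightarrow> ereal" where
  "FltR X = Sup {ereal (lattice_width K) | K. convex_body K \<and> \<not> contains_R_unimodular_copy K X}"

end

theory Submission
  imports Defs "HOL-Real_Asymp.Real_Asymp"
begin

text \<open>
  Scaling by \<open>s > 0\<close> multiplies lattice width by \<open>s\<close>, so both inequalities compare the two
  suprema by rescaling the competing bodies.
  If \<open>K\<close> contains no \<open>\<real>\<close>-unimodular copy of \<open>X\<close>, then \<open>n K\<close> contains no unimodular copy of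
  \<open>n X\<close>, since \<open>A (n X) + b \<subseteq> n K\<close> rescales to \<open>A X + b/n \<subseteq> K\<close>.
  Conversely, if \<open>A X + b \<subseteq> K / (n + \<lambda>)\<close>, then \<open>K\<close> contains
  \<open>A ((n + \<lambda>) X) + (n + \<lambda>) b \<supseteq> A (n X) + A (\<lambda> c + q) + (n + \<lambda>) b\<close> for every \<open>q \<in> [0,1]\<^sup>d\<close>,
  because \<open>\<lambda> c + q \<in> \<lambda> X\<close>; as \<open>A\<^sup>-\<^sup>1 \<int>\<^sup>d\<close> meets every unit cube, \<open>q\<close> can be chosen to make the
  translation integral.  The limit follows by squeezing.
\<close>

lemma bdd_above_abs_inner_diff:
  fixes K :: "'a::real_inner set"
  assumes "bounded K"
  shows "bdd_above ((\<lambda>p. \<bar>u \<bullet> fst p - u \<bullet> snd p\<bar>) ` (K \<times> K))"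
proof -
  obtain B where B: "\<And>x. x \<in> K \<Longrightarrow> norm x \<le> B"
    using assms bounded_iff by blast
  have "\<bar>u \<bullet> fst p - u \<bullet> snd p\<bar> \<le> norm u * (2 * B)" if "p \<in> K \<times> K" for p
  proof -
    have "\<bar>u \<bullet> fst p - u \<bullet> snd p\<bar> = \<bar>u \<bullet> (fst p - snd p)\<bar>"
      by (simp add: inner_diff_right)
    also have "\<dots> \<le> norm u * norm (fst p - snd p)"
      by (rule Cauchy_Schwarz_ineq2)
    also have "\<dots> \<le> norm u * (norm (fst p) + norm (snd p))"
      by (intro mult_left_mono norm_triangle_ineq4) auto
    also have "\<dots> \<le> norm u * (2 * B)"
      using B[of "fst p"] B[of "snd p"] that by (intro mult_left_mono) auto
    finally show ?thesis .
  qed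
  then show ?thesis by (auto intro!: bdd_aboveI2)
qed

lemma lattice_width_scaleR:
  fixes K :: "(real^'n) set"
  assumes "bounded K" "K \<noteq> {}" "s > 0"
  shows "lattice_width ((*\<^sub>R) s ` K) = s * lattice_width K"
proof -
  define h where "h u = (SUP p \<in> K \<times> K. \<bar>u \<bullet> fst p - u \<bullet> snd p\<bar>)" for u :: "real^'n"
  have h_scaleR: "(SUP p \<in> (*\<^sub>R) s ` K \<times> (*\<^sub>R) s ` K. \<bar>u \<bullet> fst p - u \<bullet> snd p\<bar>) = s * h u"
    for u
  proof -
    have pairs: "(*\<^sub>R) s ` K \<times> (*\<^sub>R) s ` K = (\<lambda>p. (s *\<^sub>R fst p, s *\<^sub>R snd p)) ` (K \<times> K)"
      by force
    have "\<bar>s * (u \<bullet> a) - s * (u \<bullet> b)\<bar> = s * \<bar>u \<bullet> a - u \<bullet> b\<bar>" for a b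
      using assms(3) by (simp only: flip: right_diff_distrib) (simp add: abs_mult)
    then have "(SUP p \<in> (*\<^sub>R) s ` K \<times> (*\<^sub>R) s ` K. \<bar>u \<bullet> fst p - u \<bullet> snd p\<bar>)
        = (SUP p \<in> K \<times> K. s * \<bar>u \<bullet> fst p - u \<bullet> snd p\<bar>)"
      unfolding pairs image_image by simp
    also have "\<dots> = s * h u"
      unfolding h_def
      using assms bdd_above_abs_inner_diff[OF assms(1)]
      by (subst continuous_at_Sup_mono[where f="\<lambda>t. s * t"])
         (auto simp: mono_def image_image intro!: continuous_intros)
    finally show ?thesis .
  qed
  have functionals_nonempty: "{u. int_vec u \<and> u \<noteq> (0::real^'n)} \<noteq> {}"
  proof -
    have "int_vec (vec 1 :: real^'n)" "(vec 1 :: real^'n) \<noteq> 0"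
      by (auto simp: int_vec_def vec_eq_iff)
    then show ?thesis by blast
  qed
  have h_nonneg: "h u \<ge> 0" for u
  proof -
    obtain x where "x \<in> K" using assms(2) by blast
    then have "\<bar>u \<bullet> fst (x, x) - u \<bullet> snd (x, x)\<bar> \<le> h u"
      unfolding h_def using bdd_above_abs_inner_diff[OF assms(1)] by (intro cSUP_upper) auto
    then show ?thesis by simp
  qed
  have "lattice_width ((*\<^sub>R) s ` K) = (INF u \<in> {u. int_vec u \<and> u \<noteq> 0}. s * h u)"
    unfolding lattice_width_def h_scaleR ..
  also have "\<dots> = s * (INF u \<in> {u. int_vec u \<and> u \<noteq> 0}. h u)"
    using assms functionals_nonempty h_nonneg
    by (subst continuous_at_Inf_mono[where f="\<lambda>t. s * t"])
       (auto simp: mono_def image_image intro!: continuous_intros bdd_belowI2)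
  also have "\<dots> = s * lattice_width K"
    unfolding lattice_width_def h_def ..
  finally show ?thesis .
qed

lemma convex_body_scaleR:
  fixes K :: "(real^'n) set"
  assumes "convex_body K"
  shows "convex_body ((*\<^sub>R) s ` K)"
  using assms unfolding convex_body_def by (auto intro: compact_scaling convex_scaling)

lemma int_vec_matrix_vector_mult:
  fixes A :: "real^'n^'n"
  assumes "\<forall>i j. A $ i $ j \<in> \<int>" "int_vec x"
  shows "int_vec (A *v x)"
  using assms unfolding int_vec_def
  by (auto simp: matrix_vector_mult_def intro!: Ints_sum Ints_mult)

lemma GL_int_unit_cube_hits_lattice:
  fixes A :: "real^'n^'n"
  assumes "GL_int A"
  shows "\<exists>q. (\<forall>i. 0 \<le> q $ i \<and> q $ i \<le> 1) \<and> int_vec (A *v q + w)"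
proof -
  have "invertible A"
    using assms by (auto simp: GL_int_def invertible_det_nz)
  then obtain B where AB: "A ** B = mat 1"
    unfolding invertible_def by blast
  define v where "v = B *v (- w)"
  define v_floor :: "real^'n" where "v_floor = (\<chi> i. of_int \<lfloor>v $ i\<rfloor>)"
  have "A *v (v - v_floor) + w = - (A *v v_floor)"
    by (simp add: v_def matrix_vector_mult_diff_distrib matrix_vector_mul_assoc AB)
  moreover have "int_vec (A *v v_floor)"
    using assms by (intro int_vec_matrix_vector_mult) (auto simp: GL_int_def int_vec_def v_floor_def)
  then have "int_vec (- (A *v v_floor))"
    by (auto simp: int_vec_def)
  moreover have "\<forall>i. 0 \<le> (v - v_floor) $ i \<and> (v - v_floor) $ i \<le> 1"
    by (auto simp: v_floor_def) (smt (verit) of_int_floor_le real_of_int_floor_add_one_gt)+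
  ultimately show ?thesis by metis
qed

lemma contains_R_unimodular_copy_if_scaled:
  fixes K X :: "(real^'n) set"
  assumes "n \<noteq> 0" "contains_unimodular_copy ((*\<^sub>R) n ` K) ((*\<^sub>R) n ` X)"
  shows "contains_R_unimodular_copy K X"
proof -
  obtain A b where A: "GL_int A" and copy: "unimodular_copy A b ((*\<^sub>R) n ` X) \<subseteq> (*\<^sub>R) n ` K"
    using assms(2) unfolding contains_unimodular_copy_def by blast
  have "unimodular_copy A ((1 / n) *\<^sub>R b) X \<subseteq> K"
  proof
    fix z assume "z \<in> unimodular_copy A ((1 / n) *\<^sub>R b) X"
    then obtain x where x: "x \<in> X" "z = A *v x + (1 / n) *\<^sub>R b"
      unfolding unimodular_copy_def by blast
    have "A *v (n *\<^sub>R x) + b \<in> (*\<^sub>R) n ` K"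
      using copy x(1) unfolding unimodular_copy_def by blast
    then obtain y where y: "y \<in> K" "A *v (n *\<^sub>R x) + b = n *\<^sub>R y"
      by blast
    have "z = (1 / n) *\<^sub>R (A *v (n *\<^sub>R x) + b)"
      using assms(1) x(2) by (simp add: matrix_vector_mult_scaleR scaleR_add_right)
    then show "z \<in> K"
      using y assms(1) by simp
  qed
  then show ?thesis
    using A unfolding contains_R_unimodular_copy_def by blast
qed

lemma contains_unimodular_copy_if_R_copy_in_shrunk:
  fixes X K :: "(real^'n) set" and c :: "real^'n"
  assumes "convex X" "n \<ge> 0" "lam > 0"
    and cube: "{c + (1 / lam) *\<^sub>R x | x. \<forall>i. 0 \<le> x $ i \<and> x $ i \<le> 1} \<subseteq> X"
    and "contains_R_unimodular_copy ((*\<^sub>R) (1 / (n + lam)) ` K) X"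
  shows "contains_unimodular_copy K ((*\<^sub>R) n ` X)"
proof -
  define s where "s = n + lam"
  have s: "s > 0"
    using assms(2,3) by (simp add: s_def)
  obtain A b where A: "GL_int A" and copy: "unimodular_copy A b X \<subseteq> (*\<^sub>R) (1 / s) ` K"
    using assms(5) unfolding contains_R_unimodular_copy_def s_def by blast
  obtain q where q: "\<forall>i. 0 \<le> q $ i \<and> q $ i \<le> 1"
    and t_int: "int_vec (A *v q + (A *v (lam *\<^sub>R c) + s *\<^sub>R b))"
    using GL_int_unit_cube_hits_lattice[OF A] by blast
  define t where "t = A *v q + (A *v (lam *\<^sub>R c) + s *\<^sub>R b)"
  have cq: "c + (1 / lam) *\<^sub>R q \<in> X"
    using cube q by blast
  have "unimodular_copy A t ((*\<^sub>R) n ` X) \<subseteq> K"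
  proof
    fix z assume "z \<in> unimodular_copy A t ((*\<^sub>R) n ` X)"
    then obtain x where x: "x \<in> X" "z = A *v (n *\<^sub>R x) + t"
      unfolding unimodular_copy_def by blast
    define x' where "x' = (n / s) *\<^sub>R x + (lam / s) *\<^sub>R (c + (1 / lam) *\<^sub>R q)"
    have "x' \<in> X"
      unfolding x'_def using convexD[OF assms(1) x(1) cq, of "n / s" "lam / s"] assms(2,3) s
      by (simp add: s_def flip: add_divide_distrib)
    then have "A *v x' + b \<in> (*\<^sub>R) (1 / s) ` K"
      using copy unfolding unimodular_copy_def by blast
    then obtain y where y: "y \<in> K" "A *v x' + b = (1 / s) *\<^sub>R y"
      by blast
    have "s *\<^sub>R x' = n *\<^sub>R x + lam *\<^sub>R c + q"
      unfolding x'_def using s assms(3) by (simp add: scaleR_add_right)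
    then have "z = s *\<^sub>R (A *v x' + b)"
      unfolding x(2) t_def
      by (simp add: scaleR_add_right matrix_vector_mult_scaleR[symmetric] matrix_vector_right_distrib)
    then show "z \<in> K"
      using y s by simp
  qed
  then show ?thesis
    using A t_int unfolding contains_unimodular_copy_def t_def by blast
qed

lemma FltR_le_Flt_scaleR:
  fixes X :: "(real^'n) set"
  assumes "n > 0"
  shows "FltR X \<le> ereal (1 / n) * Flt ((*\<^sub>R) n ` X)"
  unfolding FltR_def
proof (rule Sup_least, clarify)
  fix K :: "(real^'n) set"
  assume K: "convex_body K" "\<not> contains_R_unimodular_copy K X"
  have "\<not> contains_unimodular_copy ((*\<^sub>R) n ` K) ((*\<^sub>R) n ` X)"
    using K(2) assms contains_R_unimodular_copy_if_scaled[of n K X] by force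
  then have nK_le: "ereal (lattice_width ((*\<^sub>R) n ` K)) \<le> Flt ((*\<^sub>R) n ` X)"
    unfolding Flt_def using convex_body_scaleR[OF K(1)] by (intro Sup_upper) blast
  have "lattice_width ((*\<^sub>R) n ` K) = n * lattice_width K"
    using K(1) assms by (intro lattice_width_scaleR) (auto simp: convex_body_def compact_imp_bounded)
  then have "ereal (lattice_width K) = ereal (1 / n) * ereal (lattice_width ((*\<^sub>R) n ` K))"
    using assms by simp
  also have "\<dots> \<le> ereal (1 / n) * Flt ((*\<^sub>R) n ` X)"
    using assms nK_le by (intro ereal_mult_left_mono) auto
  finally show "ereal (lattice_width K) \<le> ereal (1 / n) * Flt ((*\<^sub>R) n ` X)" .
qed

lemma Flt_scaleR_le_FltR:
  fixes X :: "(real^'n) set" and c :: "real^'n"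
  assumes "convex X" "n \<ge> 0" "lam > 0"
    and "{c + (1 / lam) *\<^sub>R x | x. \<forall>i. 0 \<le> x $ i \<and> x $ i \<le> 1} \<subseteq> X"
  shows "Flt ((*\<^sub>R) n ` X) \<le> ereal (n + lam) * FltR X"
  unfolding Flt_def
proof (rule Sup_least, clarify)
  fix K :: "(real^'n) set"
  assume K: "convex_body K" "\<not> contains_unimodular_copy K ((*\<^sub>R) n ` X)"
  define s where "s = n + lam"
  have s: "s > 0"
    using assms(2,3) by (simp add: s_def)
  define K' where "K' = (*\<^sub>R) (1 / s) ` K"
  have K': "convex_body K'"
    unfolding K'_def using K(1) by (rule convex_body_scaleR)
  have "\<not> contains_R_unimodular_copy K' X"
    using K(2) contains_unimodular_copy_if_R_copy_in_shrunk[OF assms, of K]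
    unfolding K'_def s_def by blast
  then have K'_le: "ereal (lattice_width K') \<le> FltR X"
    unfolding FltR_def using K' by (intro Sup_upper) blast
  have "(*\<^sub>R) s ` K' = K"
    unfolding K'_def image_image using s by simp
  then have "lattice_width K = s * lattice_width K'"
    using lattice_width_scaleR[of K' s] K' s by (auto simp: convex_body_def compact_imp_bounded)
  then have "ereal (lattice_width K) = ereal s * ereal (lattice_width K')"
    by simp
  also have "\<dots> \<le> ereal s * FltR X"
    using s K'_le by (intro ereal_mult_left_mono) auto
  finally show "ereal (lattice_width K) \<le> ereal (n + lam) * FltR X"
    by (simp add: s_def)
qed

lemma tendsto_ereal_squeeze_mult:
  fixes g :: "'a \<Rightarrow> ereal"
  assumes bounds: "eventually (\<lambda>x. L \<le> g x \<and> g x \<le> ereal (r x) * L) F"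
    and r_pos: "eventually (\<lambda>x. r x > 0) F"
    and r_lim: "(r \<longlongrightarrow> 1) F"
  shows "(g \<longlongrightarrow> L) F"
proof (cases L)
  case (real l)
  have "((\<lambda>x. ereal (r x * l)) \<longlongrightarrow> ereal (1 * l)) F"
    using tendsto_mult[OF r_lim tendsto_const] by (rule tendsto_ereal)
  then have upper_lim: "((\<lambda>x. ereal (r x) * L) \<longlongrightarrow> L) F"
    unfolding real by simp
  have "eventually (\<lambda>x. L \<le> g x) F" "eventually (\<lambda>x. g x \<le> ereal (r x) * L) F"
    using bounds unfolding eventually_conj_iff by blast+
  then show ?thesis
    using upper_lim by (rule tendsto_sandwich[OF _ _ tendsto_const])
next
  case PInf
  have "eventually (\<lambda>x. g x = L) F"
    using bounds by (rule eventually_mono) (simp add: PInf)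
  then show ?thesis
    by (rule tendsto_eventually)
next
  case MInf
  have "eventually (\<lambda>x. g x = L) F"
    using eventually_conj[OF bounds r_pos] by (rule eventually_mono) (auto simp: MInf)
  then show ?thesis
    by (rule tendsto_eventually)
qed

theorem mainTheorem9:
  fixes X :: "(real^'n) set" and lam :: real and c :: "real^'n"
  assumes "convex_body X"
    and "interior X \<noteq> {}"
    and "lam > 0"
    and "{c + (1 / lam) *\<^sub>R x | x. \<forall>i. 0 \<le> x $ i \<and> x $ i \<le> 1} \<subseteq> X"
  shows "(\<forall>n::real. n > 0 \<longrightarrow>
            FltR X \<le> ereal (1 / n) * Flt ((\<lambda>x. n *\<^sub>R x) ` X)
          \<and> ereal (1 / n) * Flt ((\<lambda>x. n *\<^sub>R x) ` X) \<le> ereal ((n + lam) / n) * FltR X)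
       \<and> ((\<lambda>n::real. ereal (1 / n) * Flt ((\<lambda>x. n *\<^sub>R x) ` X)) \<longlongrightarrow> FltR X) at_top"
proof -
  define g where "g n = ereal (1 / n) * Flt ((*\<^sub>R) n ` X)" for n :: real
  have bounds: "FltR X \<le> g n \<and> g n \<le> ereal ((n + lam) / n) * FltR X" if "n > 0" for n
  proof
    show "FltR X \<le> g n"
      unfolding g_def using that by (rule FltR_le_Flt_scaleR)
    have "g n \<le> ereal (1 / n) * (ereal (n + lam) * FltR X)"
      unfolding g_def using that assms Flt_scaleR_le_FltR[of X n lam c]
      by (intro ereal_mult_left_mono) (auto simp: convex_body_def)
    then show "g n \<le> ereal ((n + lam) / n) * FltR X"
      by (simp add: mult.assoc[symmetric])
  qed
  have "(g \<longlongrightarrow> FltR X) at_top"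
  proof (rule tendsto_ereal_squeeze_mult)
    show "eventually (\<lambda>n. FltR X \<le> g n \<and> g n \<le> ereal ((n + lam) / n) * FltR X) at_top"
      using eventually_gt_at_top[of 0] by (rule eventually_mono) (rule bounds)
    show "eventually (\<lambda>n. (n + lam) / n > 0) at_top"
      using assms(3) by real_asymp
    show "((\<lambda>n. (n + lam) / n) \<longlongrightarrow> 1) at_top"
      by real_asymp
  qed
  then show ?thesis
    using bounds unfolding g_def by blast
qed

end
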